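(* Let $\mathcal{H}$ be a non-trivial complex Hilbert space, let $A\neq 0$ be a positive operator on $\mathcal{H}$, and let $T\in \mathcal{B}_{A^{1/2}}(\mathcal{H})$. Then $$r_A(T)=\lim_{n\to\infty}\|T^n\|_A^{1/n}.$$
   Context: $\mathcal{B}(\mathcal{H})$ is the algebra of bounded linear operators on $\mathcal{H}$; inner product $\langle\cdot\mid\cdot\rangle$. $A\in\mathcal{B}(\mathcal{H})$ is positive if $\langle Ax\mid x\rangle\ge 0$ for all $x\in\mathcal{H}$. Put $\langle x\mid y\rangle_A:=\langle Ax\mid y\rangle$ and $\|x\|_A:=\langle x\mid x\rangle_A^{1/2}$ (a seminorm). $\mathcal{B}_{A^{1/2}}(\mathcal{H})$ is the set of $A$-bounded operators: those $T\in\mathcal{B}(\mathcal{H})$ for which there is $\lambda>0$ with $\|Tx\|_A\le\lambda\|x\|_A$ for all $x\in\mathcal{H}$. For such $T$, $\|T\|_A:=\sup\{\|Tx\|_A/\|x\|_A : x\in\overline{\mathcal{R}(A)},\ x\neq 0\}$, where $\mathcal{R}(A)$ is the range of $A$ (closure in the norm of $\mathcal{H}$). The $A$-spectral radius of $T\in\mathcal{B}_{A^{1/2}}(\mathcal{H})$ is defined as $r_A(T):=\inf_{n\in\mathbb{N}^*}\|T^n\|_A^{1/n}$, with $\mathbb{N}^*$ the set of positive integers. *)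

theory Defs
  imports "HOL-Analysis.Analysis"
begin

text \<open>
  A complex inner product space is a real normed space with a compatible complex scalar
  multiplication whose norm comes from the inner product.  The inner product is linear in its
  first and conjugate-linear in its second argument.  Positive definiteness is contained in
  axiom \<open>cinner_self\<close>.
\<close>
class complex_inner = real_normed_vector +
  fixes scaleC :: "complex \<Rightarrow> 'a \<Rightarrow> 'a"  (infixr \<open>*\<^sub>C\<close> 75)
    and cinner :: "'a \<Rightarrow> 'a \<Rightarrow> complex"
  assumes scaleC_add_right: "c *\<^sub>C (x + y) = c *\<^sub>C x + c *\<^sub>C y"
    and scaleC_add_left: "(c + d) *\<^sub>C x = c *\<^sub>C x + d *\<^sub>C x"
    and scaleC_scaleC: "c *\<^sub>C d *\<^sub>C x = (c * d) *\<^sub>C x"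
    and scaleC_of_real: "complex_of_real r *\<^sub>C x = r *\<^sub>R x"
    and cinner_add_left: "cinner (x + y) z = cinner x z + cinner y z"
    and cinner_scaleC_left: "cinner (c *\<^sub>C x) y = c * cinner x y"
    and cinner_commute: "cinner x y = cnj (cinner y x)"
    and cinner_self: "cinner x x = complex_of_real ((norm x)\<^sup>2)"

class complex_hilbert_space = complex_inner + complete_space

instantiation complex :: complex_hilbert_space
begin

definition scaleC_complex :: "complex \<Rightarrow> complex \<Rightarrow> complex"
  where "scaleC_complex c x = c * x"

definition cinner_complex :: "complex \<Rightarrow> complex \<Rightarrow> complex"
  where "cinner_complex x y = x * cnj y"

instance
  by standard
    (simp_all add: scaleC_complex_def cinner_complex_def algebra_simps scaleR_conv_of_real
      complex_norm_square[symmetric])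

end

definition bounded_clinear :: "('a::complex_inner \<Rightarrow> 'a) \<Rightarrow> bool"
  where "bounded_clinear T \<longleftrightarrow> bounded_linear T \<and> (\<forall>c x. T (c *\<^sub>C x) = c *\<^sub>C T x)"

text \<open>\<open>\<real>\<^sub>\<ge>\<^sub>0\<close> is a set of complex numbers here, so that the form is required to be real as well.\<close>
definition positive_operator :: "('a::complex_inner \<Rightarrow> 'a) \<Rightarrow> bool"
  where "positive_operator A \<longleftrightarrow> bounded_clinear A \<and> (\<forall>x. cinner (A x) x \<in> \<real>\<^sub>\<ge>\<^sub>0)"

definition A_inner :: "('a::complex_inner \<Rightarrow> 'a) \<Rightarrow> 'a \<Rightarrow> 'a \<Rightarrow> complex"
  where "A_inner A x y = cinner (A x) y"

definition A_norm :: "('a::complex_inner \<Rightarrow> 'a) \<Rightarrow> 'a \<Rightarrow> real"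
  where "A_norm A x = sqrt (Re (A_inner A x x))"

definition A_bounded_operators :: "('a::complex_inner \<Rightarrow> 'a) \<Rightarrow> ('a \<Rightarrow> 'a) set"
  where "A_bounded_operators A =
    {T. bounded_clinear T \<and> (\<exists>c>0. \<forall>x. A_norm A (T x) \<le> c * A_norm A x)}"

text \<open>
  For positive \<open>A\<close>, \<^term>\<open>A_norm A\<close> vanishes only at \<open>0\<close> on the closure of the range, so no
  division by zero occurs.  For \<open>A \<noteq> 0\<close> and \<open>T\<close> in \<^term>\<open>A_bounded_operators A\<close>, the set is
  nonempty and bounded above, so the real supremum is the intended one.
\<close>
definition A_opnorm :: "('a::complex_inner \<Rightarrow> 'a) \<Rightarrow> ('a \<Rightarrow> 'a) \<Rightarrow> real"
  where "A_opnorm A T =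
    Sup {A_norm A (T x) / A_norm A x | x. x \<in> closure (range A) \<and> x \<noteq> 0}"

definition A_spectral_radius :: "('a::complex_inner \<Rightarrow> 'a) \<Rightarrow> ('a \<Rightarrow> 'a) \<Rightarrow> real"
  where "A_spectral_radius A T = (INF n\<in>{1..}. root n (A_opnorm A (T ^^ n)))"

end

theory Submission
  imports Defs
begin

text \<open>
  The supremum defining \<open>\<parallel>T\<parallel>\<^sub>A\<close> runs over the closure of the range of \<open>A\<close> only, but it bounds
  \<open>\<parallel>Tx\<parallel>\<^sub>A \<le> \<parallel>T\<parallel>\<^sub>A \<parallel>x\<parallel>\<^sub>A\<close> for every \<open>x\<close>, because the range is dense for \<open>\<parallel>\<cdot>\<parallel>\<^sub>A\<close>.  Density needs no
  orthogonal projection: for \<open>u\<^sub>n = (1 - A/K)\<^sup>n x\<close> with \<open>K \<ge> \<parallel>A\<parallel>\<close>, the difference \<open>x - u\<^sub>n\<close> lies in the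
  range, and \<open>\<parallel>u\<^sub>n\<^sub>+\<^sub>1\<parallel>\<^sup>2 \<le> \<parallel>u\<^sub>n\<parallel>\<^sup>2 - \<parallel>u\<^sub>n\<parallel>\<^sub>A\<^sup>2 / K\<close> forces \<open>\<parallel>u\<^sub>n\<parallel>\<^sub>A\<close> to become arbitrarily small.  Hence
  \<open>\<parallel>T\<^sup>n\<parallel>\<^sub>A\<close> is submultiplicative in \<open>n\<close>, and Fekete's lemma applies.
\<close>

section \<open>Fekete's lemma for nonnegative submultiplicative sequences\<close>

lemma submultiplicative_power_mult:
  fixes a :: "nat \<Rightarrow> real"
  assumes nonneg: "\<And>n. 0 \<le> a n"
    and submult: "\<And>m n. a (m + n) \<le> a m * a n"
  shows "a (q * k + r) \<le> a k ^ q * a r"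
proof (induction q)
  case (Suc q)
  have "a (Suc q * k + r) \<le> a k * a (q * k + r)"
    using submult[of k "q * k + r"] by (simp add: algebra_simps)
  also have "\<dots> \<le> a k * (a k ^ q * a r)"
    by (intro mult_left_mono Suc.IH nonneg)
  finally show ?case by (simp add: algebra_simps)
qed simp

text \<open>The infimum bounds every term with \<open>n \<ge> 1\<close> from below. For the upper
  bound, one \<open>k\<close> whose root is nearly minimal suffices: dividing \<open>n\<close> by
  \<open>k\<close> with remainder gives \<open>a n \<le> c ^ n * M\<close> with \<open>M\<close>
  independent of \<open>n\<close>, and \<open>root n M\<close> tends to 1.\<close>

lemma submultiplicative_root_tendsto_INF:
  fixes a :: "nat \<Rightarrow> real"
  assumes nonneg: "\<And>n. 0 \<le> a n"
    and submult: "\<And>m n. a (m + n) \<le> a m * a n"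
  shows "(\<lambda>n. root n (a n)) \<longlonglongrightarrow> (INF n\<in>{1..}. root n (a n))"
proof -
  define L where "L = (INF n\<in>{1..}. root n (a n))"
  have bdd: "bdd_below ((\<lambda>n. root n (a n)) ` {1..})"
    by (intro bdd_belowI[of _ 0]) (auto simp: nonneg)
  have L_le: "L \<le> root n (a n)" if "n \<ge> 1" for n
    unfolding L_def using that by (intro cINF_lower[OF bdd]) auto
  have L_nonneg: "0 \<le> L"
    unfolding L_def by (intro cINF_greatest) (auto simp: nonneg)
  have "(\<lambda>n. root n (a n)) \<longlonglongrightarrow> L"
  proof (rule order_tendstoI)
    fix l assume "l < L"
    then show "\<forall>\<^sub>F n in sequentially. l < root n (a n)"
      using L_le by (intro eventually_sequentiallyI[of 1]) (meson less_le_trans)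
  next
    fix u assume "L < u"
    \<comment> \<open>The gap between \<open>c\<close> and \<open>u\<close> absorbs the factor
      \<open>root n M\<close>; positivity of \<open>c\<close> permits division by its
      powers.\<close>
    define c where "c = (L + u) / 2"
    have c: "L < c" "c < u" "0 < c"
      using \<open>L < u\<close> L_nonneg by (auto simp: c_def)
    have "\<exists>k\<in>{1..}. root k (a k) < c"
      using c(1) bdd unfolding L_def by (subst (asm) cINF_less_iff) auto
    then obtain k where k: "k \<ge> 1" "root k (a k) < c"
      by auto
    have "a k = root k (a k) ^ k"
      using k nonneg by simp
    also have "\<dots> \<le> c ^ k"
      using k nonneg by (intro power_mono) auto
    finally have ak: "a k \<le> c ^ k" .
    \<comment> \<open>The sum dominates the contribution of every possible remainder; the summand 1
      makes \<open>M\<close> positive, as \<open>root n M\<close> tending to 1 requires.\<close>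
    define M where "M = 1 + (\<Sum>r<k. a r / c ^ r)"
    have M: "0 < M"
      unfolding M_def using c nonneg by (intro add_pos_nonneg sum_nonneg) auto
    have a_le: "a n \<le> c ^ n * M" for n
    proof -
      define q r where "q = n div k" and "r = n mod k"
      have n: "n = q * k + r" and "r < k"
        using k by (auto simp: q_def r_def)
      have "a r / c ^ r \<le> (\<Sum>r<k. a r / c ^ r)"
        using \<open>r < k\<close> c nonneg by (intro member_le_sum) auto
      then have "a r / c ^ r \<le> M"
        by (simp add: M_def)
      then have ar: "a r \<le> c ^ r * M"
        using c by (simp add: field_simps)
      have "a n \<le> a k ^ q * a r"
        unfolding n by (rule submultiplicative_power_mult[OF nonneg submult])
      also have "\<dots> \<le> (c ^ k) ^ q * (c ^ r * M)"
        using ak ar nonneg c by (intro mult_mono power_mono) auto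
      also have "\<dots> = c ^ n * M"
        by (simp add: n power_add power_mult[symmetric] mult.commute)
      finally show ?thesis .
    qed
    have "(\<lambda>n. c * root n M) \<longlonglongrightarrow> c * 1"
      by (intro tendsto_intros LIMSEQ_root_const M)
    then have "\<forall>\<^sub>F n in sequentially. c * root n M < u"
      using c by (intro order_tendstoD) auto
    then show "\<forall>\<^sub>F n in sequentially. root n (a n) < u"
      using eventually_ge_at_top[of 1]
    proof eventually_elim
      case (elim n)
      have "root n (a n) \<le> root n (c ^ n * M)"
        using elim a_le by simp
      also have "\<dots> = c * root n M"
        using elim c by (simp add: real_root_mult real_root_power_cancel)
      finally show ?case
        using elim by simp
    qed
  qed
  then show ?thesis
    by (simp add: L_def)
qed

section \<open>The semi-inner product and seminorm of a positive operator\<close>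

lemma bounded_clinear_linear: "bounded_clinear T \<Longrightarrow> linear T"
  by (simp add: bounded_clinear_def bounded_linear.linear)

lemma cinner_add_right: "cinner x (y + z) = cinner x y + cinner x z"
  by (metis cinner_add_left cinner_commute complex_cnj_add)

lemma cinner_scaleC_right: "cinner x (c *\<^sub>C y) = cnj c * cinner x y"
  by (metis cinner_commute cinner_scaleC_left complex_cnj_mult)

lemma cinner_scaleR_left: "cinner (r *\<^sub>R x) y = of_real r * cinner x y"
  by (metis cinner_scaleC_left scaleC_of_real)

lemma cinner_scaleR_right: "cinner x (r *\<^sub>R y) = of_real r * cinner x y"
  by (metis cinner_scaleC_right complex_cnj_complex_of_real scaleC_of_real)

lemma cinner_zero_left: "cinner 0 y = 0"
  using cinner_scaleR_left[of 0 0 y] by simp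

lemma A_inner_self_nonneg:
  assumes "positive_operator A"
  shows "0 \<le> Re (A_inner A x x)"
  using assms by (auto simp: positive_operator_def A_inner_def complex_nonneg_Reals_iff)

text \<open>Polarization: the form is real on the diagonal, and its imaginary part at
  \<open>x + \<i> *\<^sub>C y\<close> is exactly the difference of the two sides.\<close>

lemma Re_A_inner_commute:
  assumes "positive_operator A"
  shows "Re (A_inner A x y) = Re (A_inner A y x)"
proof -
  let ?z = "\<i> *\<^sub>C y"
  have lin: "linear A" and C: "A ?z = \<i> *\<^sub>C A y"
    using assms by (auto simp: positive_operator_def bounded_clinear_def bounded_linear.linear)
  have real: "Im (cinner (A v) v) = 0" for v
    using assms by (auto simp: positive_operator_def complex_nonneg_Reals_iff)
  have "Im (cinner (A (x + ?z)) (x + ?z)) = Re (cinner (A y) x) - Re (cinner (A x) y)"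
    by (simp add: linear_add[OF lin] C cinner_add_left cinner_add_right cinner_scaleC_left
        cinner_scaleC_right real)
  then show ?thesis
    using real[of "x + ?z"] by (simp add: A_inner_def)
qed

lemma A_inner_add_self:
  assumes "positive_operator A"
  shows "Re (A_inner A (x + t *\<^sub>R y) (x + t *\<^sub>R y))
    = Re (A_inner A x x) + 2 * t * Re (A_inner A x y) + t\<^sup>2 * Re (A_inner A y y)"
proof -
  have lin: "linear A"
    using assms by (simp add: positive_operator_def bounded_clinear_linear)
  show ?thesis
    using Re_A_inner_commute[OF assms, of x y]
    by (simp add: A_inner_def linear_add[OF lin] linear_cmul[OF lin] cinner_add_left
        cinner_add_right cinner_scaleR_left cinner_scaleR_right algebra_simps power2_eq_square)
qed

lemma A_inner_Cauchy_Schwarz: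
  assumes "positive_operator A"
  shows "(Re (A_inner A x y))\<^sup>2 \<le> Re (A_inner A x x) * Re (A_inner A y y)"
proof -
  define p q r where "p = Re (A_inner A x x)" and "q = Re (A_inner A x y)"
    and "r = Re (A_inner A y y)"
  have nonneg: "0 \<le> p + 2 * t * q + t\<^sup>2 * r" for t
    using A_inner_self_nonneg[OF assms, of "x + t *\<^sub>R y"]
    by (simp add: A_inner_add_self[OF assms] p_def q_def r_def)
  have "q\<^sup>2 \<le> p * r"
  proof (cases "r = 0")
    case True
    have "q = 0"
    proof (rule ccontr)
      assume "q \<noteq> 0"
      then show False
        \<comment> \<open>With \<open>r = 0\<close> the quadratic is affine in \<open>t\<close>, and
          this \<open>t\<close> gives it the value -1.\<close>
        using nonneg[of "- (p + 1) / (2 * q)"] True by (simp add: field_simps)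
    qed
    then show ?thesis using True by simp
  next
    case False
    then have "r > 0"
      using A_inner_self_nonneg[OF assms, of y] by (simp add: r_def)
    \<comment> \<open>The quadratic attains its minimum at \<open>t = - q / r\<close>.\<close>
    have "p + 2 * (- q / r) * q + (- q / r)\<^sup>2 * r = p - q\<^sup>2 / r"
      using \<open>r > 0\<close> by (simp add: field_simps power2_eq_square)
    then have "0 \<le> p - q\<^sup>2 / r"
      using nonneg[of "- q / r"] by linarith
    then show ?thesis
      using \<open>r > 0\<close> by (simp add: field_simps)
  qed
  then show ?thesis by (simp add: p_def q_def r_def)
qed

lemma A_norm_nonneg: "positive_operator A \<Longrightarrow> 0 \<le> A_norm A x"
  by (simp add: A_norm_def A_inner_self_nonneg)

lemma A_norm_power2: "positive_operator A \<Longrightarrow> (A_norm A x)\<^sup>2 = Re (A_inner A x x)"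
  by (simp add: A_norm_def A_inner_self_nonneg)

lemma A_norm_triangle:
  assumes "positive_operator A"
  shows "A_norm A (x + y) \<le> A_norm A x + A_norm A y"
proof (rule power2_le_imp_le)
  have "(Re (A_inner A x y))\<^sup>2 \<le> (A_norm A x * A_norm A y)\<^sup>2"
    using A_inner_Cauchy_Schwarz[OF assms] by (simp add: power_mult_distrib A_norm_power2 assms)
  then have "Re (A_inner A x y) \<le> A_norm A x * A_norm A y"
    by (rule power2_le_imp_le) (simp add: A_norm_nonneg assms)
  then show "(A_norm A (x + y))\<^sup>2 \<le> (A_norm A x + A_norm A y)\<^sup>2"
    using A_inner_add_self[OF assms, of x 1 y]
    by (simp add: power2_sum A_norm_power2 assms)
qed (simp add: A_norm_nonneg assms)

lemma A_norm_minus_commute: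
  assumes "positive_operator A"
  shows "A_norm A (x - y) = A_norm A (y - x)"
  \<comment> \<open>Adding -2 times \<open>x - y\<close> to itself yields \<open>y - x\<close>, and
    the coefficients of the expansion sum to 1 - 4 + 4 = 1.\<close>
  using A_inner_add_self[OF assms, of "x - y" "-2" "x - y"]
  by (simp add: A_norm_def scaleR_2)

section \<open>Comparison with the Hilbert space norm, and density of the range\<close>

lemma positive_operator_id: "positive_operator (\<lambda>x. x)"
  by (simp add: positive_operator_def bounded_clinear_def cinner_self)

lemma Re_cinner_le_norm: "Re (cinner x y) \<le> norm x * norm y"
proof (rule power2_le_imp_le)
  show "(Re (cinner x y))\<^sup>2 \<le> (norm x * norm y)\<^sup>2"
    using A_inner_Cauchy_Schwarz[OF positive_operator_id, of x y]
    by (simp add: A_inner_def cinner_self power_mult_distrib)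
qed simp

text \<open>Cauchy-Schwarz for the form of \<open>A\<close>, applied to \<open>x\<close> and
  \<open>A x\<close>, bounds the fourth power of \<open>norm (A x)\<close>; a factor
  \<open>(norm (A x))\<^sup>2\<close> then cancels.\<close>

lemma norm_positive_operator_le:
  assumes A: "positive_operator A" and K: "\<And>x. norm (A x) \<le> K * norm x"
  shows "(norm (A x))\<^sup>2 \<le> K * (A_norm A x)\<^sup>2"
proof (cases "A x = 0")
  case True
  then show ?thesis
    by (simp add: A_norm_def A_inner_def cinner_zero_left)
next
  case False
  have "Re (A_inner A x (A x)) = (norm (A x))\<^sup>2"
    by (simp add: A_inner_def cinner_self)
  then have "((norm (A x))\<^sup>2)\<^sup>2 \<le> (A_norm A x)\<^sup>2 * Re (cinner (A (A x)) (A x))"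
    using A_inner_Cauchy_Schwarz[OF A, of x "A x"] by (simp add: A_norm_power2 A A_inner_def)
  also have "Re (cinner (A (A x)) (A x)) \<le> norm (A (A x)) * norm (A x)"
    by (rule Re_cinner_le_norm)
  also have "norm (A (A x)) * norm (A x) \<le> K * norm (A x) * norm (A x)"
    by (intro mult_right_mono K) auto
  finally have "((norm (A x))\<^sup>2)\<^sup>2 \<le> (A_norm A x)\<^sup>2 * (K * norm (A x) * norm (A x))"
    by (simp add: mult_left_mono)
  then have "(norm (A x))\<^sup>2 * (norm (A x))\<^sup>2 \<le> (K * (A_norm A x)\<^sup>2) * (norm (A x))\<^sup>2"
    by (simp add: power2_eq_square algebra_simps)
  then show ?thesis
    using False by (metis mult_right_le_imp_le zero_less_norm_iff zero_less_power)
qed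

text \<open>Expanding the square, the cross term contributes
  \<open>- 2 * (A_norm A x)\<^sup>2 / K\<close>, and the bound on \<open>norm (A x)\<close> shows
  that the last term gives back at most half of it.\<close>

lemma norm_diff_positive_operator_le:
  assumes A: "positive_operator A" and "K > 0" and K: "\<And>x. norm (A x) \<le> K * norm x"
  shows "(norm (x - (1 / K) *\<^sub>R A x))\<^sup>2 \<le> (norm x)\<^sup>2 - (A_norm A x)\<^sup>2 / K"
proof -
  have "(norm (x - (1 / K) *\<^sub>R A x))\<^sup>2
      = (norm x)\<^sup>2 - 2 * (A_norm A x)\<^sup>2 / K + (norm (A x))\<^sup>2 / K\<^sup>2"
    using A_inner_add_self[OF positive_operator_id, of x "- (1 / K)" "A x"]
      Re_A_inner_commute[OF positive_operator_id, of x "A x"]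
    by (simp add: A_norm_power2[OF A] A_inner_def cinner_self power_divide)
  also have "(norm (A x))\<^sup>2 / K\<^sup>2 \<le> (K * (A_norm A x)\<^sup>2) / K\<^sup>2"
    by (intro divide_right_mono norm_positive_operator_le[OF A K]) auto
  also have "\<dots> = (A_norm A x)\<^sup>2 / K"
    using \<open>K > 0\<close> by (simp add: power2_eq_square)
  finally show ?thesis by simp
qed

lemma range_A_norm_dense:
  assumes A: "positive_operator A" and "d > 0"
  shows "\<exists>y\<in>range A. A_norm A (x - y) < d"
proof -
  have bl: "bounded_linear A"
    using A by (simp add: positive_operator_def bounded_clinear_def)
  then obtain K where "K > 0" and K: "\<And>x. norm (A x) \<le> K * norm x"
    using bounded_linear.pos_bounded by (metis mult.commute)
  have lin: "linear A"
    using bl by (rule bounded_linear.linear)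
  define u where "u n = ((\<lambda>v. v - (1 / K) *\<^sub>R A v) ^^ n) x" for n
  have u_Suc: "u (Suc n) = u n - (1 / K) *\<^sub>R A (u n)" for n
    by (simp add: u_def)
  have range: "x - u n \<in> range A" for n
  proof (induction n)
    case 0
    then show ?case
      using linear_0[OF lin] by (auto simp: u_def intro: range_eqI[of _ _ 0])
  next
    case (Suc n)
    then obtain w where "x - u n = A w" by auto
    then have "x - u (Suc n) = A (w + (1 / K) *\<^sub>R u n)"
      by (simp add: u_Suc linear_add[OF lin] linear_cmul[OF lin] algebra_simps)
    then show ?case by auto
  qed
  have "\<exists>n. A_norm A (u n) < d"
  proof (rule ccontr)
    assume "\<not> ?thesis"
    then have "d\<^sup>2 \<le> (A_norm A (u n))\<^sup>2" for n
      using \<open>d > 0\<close> by (intro power_mono) (auto simp: not_less)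
    then have step: "(norm (u (Suc n)))\<^sup>2 \<le> (norm (u n))\<^sup>2 - d\<^sup>2 / K" for n
      using norm_diff_positive_operator_le[OF A \<open>K > 0\<close> K, of "u n"] \<open>K > 0\<close>
        divide_right_mono[of "d\<^sup>2" "(A_norm A (u n))\<^sup>2" K]
      by (smt (verit) u_Suc)
    \<comment> \<open>The fixed loss at each step adds up, so the right-hand side would eventually
      be negative.\<close>
    have "(norm (u n))\<^sup>2 \<le> (norm x)\<^sup>2 - real n * (d\<^sup>2 / K)" for n
    proof (induction n)
      case 0
      then show ?case by (simp add: u_def)
    next
      case (Suc n)
      then show ?case using step[of n] by (simp add: algebra_simps add_divide_distrib)
    qed
    then have "real n * (d\<^sup>2 / K) \<le> (norm x)\<^sup>2" for n
      by (smt (verit) zero_le_power2)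
    moreover have "0 < d\<^sup>2 / K"
      using \<open>d > 0\<close> \<open>K > 0\<close> by simp
    ultimately show False
      using reals_Archimedean3 by (meson not_less)
  qed
  then obtain n where "A_norm A (u n) < d" by auto
  then show ?thesis
    using range[of n] by (intro bexI[of _ "x - u n"]) auto
qed

section \<open>Operators bounded for the seminorm, and their operator seminorm\<close>

lemma A_bounded_operators_obtain:
  assumes "T \<in> A_bounded_operators A"
  obtains c where "c > 0" "\<And>x. A_norm A (T x) \<le> c * A_norm A x"
  using assms by (auto simp: A_bounded_operators_def)

lemma A_bounded_operators_linear: "T \<in> A_bounded_operators A \<Longrightarrow> linear T"
  by (simp add: A_bounded_operators_def bounded_clinear_linear)

lemma A_bounded_operators_comp:
  assumes S: "S \<in> A_bounded_operators A" and T: "T \<in> A_bounded_operators A"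
  shows "S \<circ> T \<in> A_bounded_operators A"
proof -
  obtain c d where c: "c > 0" "\<And>x. A_norm A (S x) \<le> c * A_norm A x"
    and d: "d > 0" "\<And>x. A_norm A (T x) \<le> d * A_norm A x"
    using A_bounded_operators_obtain[OF S] A_bounded_operators_obtain[OF T] by metis
  have "A_norm A (S (T x)) \<le> c * d * A_norm A x" for x
    using order_trans[OF c(2) mult_left_mono[OF d(2)]] c(1) by (simp add: mult.assoc)
  moreover have "bounded_clinear (S \<circ> T)"
    using S T bounded_linear_compose[of S T]
    by (auto simp: A_bounded_operators_def bounded_clinear_def o_def)
  ultimately show ?thesis
    using mult_pos_pos[OF c(1) d(1)] by (auto simp: A_bounded_operators_def)
qed

lemma A_bounded_operators_funpow:
  assumes "T \<in> A_bounded_operators A"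
  shows "T ^^ n \<in> A_bounded_operators A"
proof (induction n)
  case 0
  show ?case
    by (auto simp: A_bounded_operators_def bounded_clinear_def id_def intro!: exI[of _ 1])
next
  case (Suc n)
  then show ?case
    unfolding funpow.simps by (rule A_bounded_operators_comp[OF assms])
qed

lemma A_opnorm_bdd_above:
  assumes A: "positive_operator A" and T: "T \<in> A_bounded_operators A"
  shows "bdd_above {A_norm A (T x) / A_norm A x | x. x \<in> closure (range A) \<and> x \<noteq> 0}"
proof -
  obtain c where c: "c > 0" "\<And>x. A_norm A (T x) \<le> c * A_norm A x"
    using A_bounded_operators_obtain[OF T] by metis
  \<comment> \<open>If \<open>A_norm A x = 0\<close>, the quotient is 0 by convention.\<close>
  have "A_norm A (T x) / A_norm A x \<le> c" for x
    using c A_norm_nonneg[OF A, of x] by (cases "A_norm A x = 0") (auto simp: divide_le_eq)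
  then show ?thesis by (intro bdd_aboveI[of _ c]) auto
qed

text \<open>The supremum is taken over a nonempty set: since \<open>A\<close> is nonzero, some
  \<open>A z\<close> is an admissible vector, and its quotient is nonnegative.\<close>

lemma A_opnorm_nonneg:
  assumes A: "positive_operator A" and "A \<noteq> (\<lambda>x. 0)" and T: "T \<in> A_bounded_operators A"
  shows "0 \<le> A_opnorm A T"
proof -
  obtain z where z: "A z \<noteq> 0" using assms(2) by auto
  have "0 \<le> A_norm A (T (A z)) / A_norm A (A z)"
    by (simp add: A_norm_nonneg A)
  also have "\<dots> \<le> A_opnorm A T"
    unfolding A_opnorm_def using z closure_subset[of "range A"]
    by (intro cSup_upper A_opnorm_bdd_above A T) auto
  finally show ?thesis .
qed

text \<open>The bound holds on the range of \<open>A\<close> by definition of the supremum. It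
  passes to all \<open>x\<close> by density, since the constant \<open>c\<close> controls
  \<open>T\<close> on the difference \<open>x - y\<close>.\<close>

lemma A_norm_le_A_opnorm_mult:
  assumes A: "positive_operator A" and nz: "A \<noteq> (\<lambda>x. 0)" and T: "T \<in> A_bounded_operators A"
  shows "A_norm A (T x) \<le> A_opnorm A T * A_norm A x"
proof -
  obtain c where c: "c > 0" "\<And>x. A_norm A (T x) \<le> c * A_norm A x"
    using A_bounded_operators_obtain[OF T] by metis
  have on_range: "A_norm A (T y) \<le> A_opnorm A T * A_norm A y" if y: "y \<in> range A" for y
  proof (cases "A_norm A y = 0")
    case True
    then show ?thesis using c(2)[of y] by simp
  next
    case False
    have "y \<noteq> 0"
    proof
      assume "y = 0"
      then have "A y = 0"
        using A linear_0 by (auto simp: positive_operator_def dest: bounded_clinear_linear)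
      then show False
        using \<open>y = 0\<close> False by (simp add: A_norm_def A_inner_def cinner_zero_left)
    qed
    then have "A_norm A (T y) / A_norm A y \<le> A_opnorm A T"
      unfolding A_opnorm_def using y closure_subset[of "range A"]
      by (intro cSup_upper A_opnorm_bdd_above A T) auto
    then show ?thesis
      using False A_norm_nonneg[OF A, of y] by (simp add: divide_le_eq)
  qed
  let ?N = "A_opnorm A T"
  have N: "0 \<le> ?N" by (rule A_opnorm_nonneg[OF A nz T])
  show ?thesis
  proof (rule field_le_epsilon)
    fix e :: real assume "e > 0"
    \<comment> \<open>Two errors occur: \<open>?N * d\<close> from replacing \<open>y\<close> by
      \<open>x\<close> on the right, and \<open>c * d\<close> from \<open>T (x - y)\<close>.\<close>
    define d where "d = e / (?N + c)"
    have "?N + c > 0" using N c(1) by simp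
    then have "d > 0" using \<open>e > 0\<close> by (simp add: d_def)
    then obtain y where y: "y \<in> range A" "A_norm A (x - y) < d"
      using range_A_norm_dense[OF A] by metis
    have "A_norm A (T x) \<le> A_norm A (T y) + A_norm A (T (x - y))"
      using A_norm_triangle[OF A, of "T y" "T (x - y)"]
      by (simp add: linear_diff[OF A_bounded_operators_linear[OF T]])
    also have "\<dots> \<le> ?N * A_norm A y + c * A_norm A (x - y)"
      by (intro add_mono on_range y c)
    also have "A_norm A y \<le> A_norm A x + A_norm A (x - y)"
      using A_norm_triangle[OF A, of x "- (x - y)"] by (simp add: A_norm_minus_commute[OF A])
    finally have "A_norm A (T x) \<le> ?N * (A_norm A x + A_norm A (x - y)) + c * A_norm A (x - y)"
      using N by (simp add: mult_left_mono)
    also have "\<dots> = ?N * A_norm A x + (?N + c) * A_norm A (x - y)"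
      by (simp add: algebra_simps)
    also have "(?N + c) * A_norm A (x - y) \<le> (?N + c) * d"
      using y \<open>?N + c > 0\<close> by (intro mult_left_mono) auto
    also have "(?N + c) * d = e"
      using \<open>?N + c > 0\<close> by (simp add: d_def)
    finally show "A_norm A (T x) \<le> ?N * A_norm A x + e" by simp
  qed
qed

text \<open>Even for \<open>x\<close> in the closure of the range, \<open>T x\<close> may lie
  outside it, so the bound for \<open>S\<close> is applied in its form valid on the whole
  space.\<close>

lemma A_opnorm_comp_le:
  assumes A: "positive_operator A" and nz: "A \<noteq> (\<lambda>x. 0)"
    and S: "S \<in> A_bounded_operators A" and T: "T \<in> A_bounded_operators A"
  shows "A_opnorm A (S \<circ> T) \<le> A_opnorm A S * A_opnorm A T"
proof -
  have N: "0 \<le> A_opnorm A S * A_opnorm A T"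
    by (intro mult_nonneg_nonneg A_opnorm_nonneg A nz S T)
  have "A_norm A (S (T x)) / A_norm A x \<le> A_opnorm A S * A_opnorm A T" for x
  proof (cases "A_norm A x = 0")
    case True
    then show ?thesis using N by simp
  next
    case False
    have "A_norm A (S (T x)) \<le> A_opnorm A S * A_norm A (T x)"
      by (rule A_norm_le_A_opnorm_mult[OF A nz S])
    also have "\<dots> \<le> A_opnorm A S * (A_opnorm A T * A_norm A x)"
      by (intro mult_left_mono A_norm_le_A_opnorm_mult A_opnorm_nonneg A nz S T)
    finally show ?thesis
      using False A_norm_nonneg[OF A, of x] by (simp add: divide_le_eq mult.assoc)
  qed
  moreover obtain z where "A z \<noteq> 0" using nz by auto
  then have "\<exists>x. x \<in> closure (range A) \<and> x \<noteq> 0"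
    using closure_subset[of "range A"] by blast
  ultimately show ?thesis
    unfolding A_opnorm_def[of A "S \<circ> T"] by (intro cSup_least) auto
qed

theorem theorem2p1:
  fixes A T :: "'a::complex_hilbert_space \<Rightarrow> 'a"
  assumes "(UNIV :: 'a set) \<noteq> {0}"
    and "positive_operator A"
    and "A \<noteq> (\<lambda>x. 0)"
    and "T \<in> A_bounded_operators A"
  shows "(\<lambda>n. root n (A_opnorm A (T ^^ n))) \<longlonglongrightarrow> A_spectral_radius A T"
  unfolding A_spectral_radius_def
\<comment> \<open>The term at \<open>n = 0\<close> is 0 because \<open>root 0\<close> is; it lies
  outside the index set of the infimum and does not affect the limit.\<close>
proof (rule submultiplicative_root_tendsto_INF)
  show "0 \<le> A_opnorm A (T ^^ n)" for n
    by (intro A_opnorm_nonneg A_bounded_operators_funpow assms)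
  show "A_opnorm A (T ^^ (m + n)) \<le> A_opnorm A (T ^^ m) * A_opnorm A (T ^^ n)" for m n
    unfolding funpow_add by (intro A_opnorm_comp_le A_bounded_operators_funpow assms)
qed

end
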